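(* (1) Let $X$ be a Lindelöf topological space that is a union of fewer than $\operatorname{add}(\mathcal{N})$ subspaces, each satisfying $\mathsf{S}_1(\mathrm{O},\mathrm{O})$ (Rothberger's property). Then $X$ satisfies $\mathsf{S}_1(\mathrm{O},\mathrm{O})$. That is, for Lindelöf spaces, $\operatorname{add}(\mathcal{N})\le\operatorname{add}(\mathsf{S}_1(\mathrm{O},\mathrm{O}))$. (2) Let $X$ be a topological space that is a union of fewer than $\operatorname{add}(\mathcal{N})$ subspaces, each satisfying $\mathsf{S}_1(\Gamma,\mathrm{O})$. Then $X$ satisfies $\mathsf{S}_1(\Gamma,\mathrm{O})$. That is, $\operatorname{add}(\mathcal{N})\le\operatorname{add}(\mathsf{S}_1(\Gamma,\mathrm{O}))$.
   Context: $\mathbb{N}=\{1,2,3,\dots\}$. The cardinal $\operatorname{add}(\mathcal{N})$ is the minimal cardinality of a family $F\subseteq\mathbb{N}^{\mathbb{N}}$ for which there is no function $S$ from $\mathbb{N}$ to the finite subsets of $\mathbb{N}$ with $|S(n)|\le n$ for all $n$, such that for each $f\in F$ we have $f(n)\in S(n)$ for all but finitely many $n$. (This equals the minimal cardinality of a family of Lebesgue null sets of reals whose union is not null.) For a topological space $X$: $\mathrm{O}(X)$ is the family of all open covers of $X$; a point-cofinite cover of $X$ is an infinite cover such that every point of $X$ belongs to all but finitely many members of the cover; $\Gamma(X)$ is the family of open point-cofinite covers of $X$. For types of covers $\mathrm{A},\mathrm{B}$, a space $X$ satisfies $\mathsf{S}_1(\mathrm{A},\mathrm{B})$ if for every sequence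 $\mathcal{U}_1,\mathcal{U}_2,\dots$ in $\mathrm{A}(X)$ there are $U_1\in\mathcal{U}_1,U_2\in\mathcal{U}_2,\dots$ such that $\{U_n:n\in\mathbb{N}\}\in\mathrm{B}(X)$. Subspaces carry the subspace topology and satisfy a property if they satisfy it as topological spaces in their own right. The additivity $\operatorname{add}(P)$ of a property $P$ is the minimum cardinality of a family of sets (subspaces of a space) satisfying $P$ whose union does not satisfy $P$. *)

theory Defs
  imports "HOL-Analysis.Analysis"
begin

unbundle cardinal_syntax

section \<open>Minimal cardinalities\<close>

text \<open>The minimum is attained whenever the class of sets is nonempty (lemma \<open>min_card_attained\<close>);
  for the empty class the value is unspecified. Cardinals are represented, up to
  \<open>=o\<close>, as in the library.\<close>

definition min_card :: "'b set set \<Rightarrow> 'b rel" where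
  "min_card \<C> = |SOME F. F \<in> \<C> \<and> (\<forall>G\<in>\<C>. |F| \<le>o |G| )|"

lemma min_card_attained:
  assumes "\<C> \<noteq> {}"
  shows "\<exists>F\<in>\<C>. min_card \<C> = |F| \<and> (\<forall>G\<in>\<C>. |F| \<le>o |G| )"
proof -
  have "\<exists>r\<in>card_of ` \<C>. \<forall>r'\<in>card_of ` \<C>. r \<le>o r'"
    by (rule exists_minim_Well_order) (use assms card_of_Well_order in auto)
  then have ex: "\<exists>F. F \<in> \<C> \<and> (\<forall>G\<in>\<C>. |F| \<le>o |G| )"
    by blast
  show ?thesis
    unfolding min_card_def using someI_ex[OF ex] by blast
qed

section \<open>The additivity of the null ideal\<close>

text \<open>Here \<open>nat\<close> contains 0. As functions are captured only at almost all arguments, the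
  extra argument 0 (where the bound forces the empty set) is harmless, and so is the extra
  value 0.\<close>

definition captured :: "(nat \<Rightarrow> nat) set \<Rightarrow> bool" where
  "captured F \<longleftrightarrow>
     (\<exists>S :: nat \<Rightarrow> nat set. (\<forall>n. finite (S n) \<and> card (S n) \<le> n) \<and>
        (\<forall>f\<in>F. \<forall>\<^sub>F n in sequentially. f n \<in> S n))"

definition add_null :: "(nat \<Rightarrow> nat) rel" where
  "add_null = min_card {F. \<not> captured F}"

lemma not_captured_UNIV: "\<not> captured UNIV"
proof
  assume "captured UNIV"
  then obtain S :: "nat \<Rightarrow> nat set" where fin: "\<And>n. finite (S n)"
    and S: "\<And>f. \<forall>\<^sub>F n in sequentially. f n \<in> S n"
    unfolding captured_def by blast
  have "\<forall>n. \<exists>m. m \<notin> S n"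
    using fin by (meson ex_new_if_finite infinite_UNIV_nat)
  then obtain f where "\<And>n. f n \<notin> S n"
    by metis
  then show False
    using S[of f] by (simp add: eventually_sequentially)
qed

section \<open>Covers and selection principles\<close>

text \<open>A cover is a nonempty family. This is automatic for nonempty spaces; for the empty
  space it rules out the empty cover, from which nothing could be selected. With it, the
  empty space is a Rothberger space, as it has to be for additivity to make sense for the
  empty family of subspaces.\<close>

definition open_covers :: "'a topology \<Rightarrow> 'a set set set" where
  "open_covers X = {\<U>. \<U> \<noteq> {} \<and> (\<forall>U\<in>\<U>. openin X U) \<and> \<Union>\<U> = topspace X}"

definition point_cofinite_covers :: "'a topology \<Rightarrow> 'a set set set" where
  "point_cofinite_covers X =
     {\<U> \<in> open_covers X. infinite \<U> \<and> (\<forall>x\<in>topspace X. finite {U\<in>\<U>. x \<notin> U})}"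

definition S1 ::
  "('a topology \<Rightarrow> 'a set set set) \<Rightarrow> ('a topology \<Rightarrow> 'a set set set) \<Rightarrow> 'a topology \<Rightarrow> bool" where
  "S1 A B X \<longleftrightarrow>
     (\<forall>\<U> :: nat \<Rightarrow> 'a set set. (\<forall>n. \<U> n \<in> A X) \<longrightarrow>
        (\<exists>U. (\<forall>n. U n \<in> \<U> n) \<and> range U \<in> B X))"

section \<open>Additivity of a property of spaces\<close>

text \<open>\<open>nonadditive_families C P\<close> consists of the families of subspaces of a space, each
  satisfying \<open>P\<close>, whose union lies in the class \<open>C\<close> of spaces but does not satisfy \<open>P\<close>.\<close>

definition nonadditive_families ::
  "('a topology \<Rightarrow> bool) \<Rightarrow> ('a topology \<Rightarrow> bool) \<Rightarrow> 'a set set set" where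
  "nonadditive_families C P =
     {\<A>. \<exists>Y. \<A> \<subseteq> Pow (topspace Y) \<and> (\<forall>A\<in>\<A>. P (subtopology Y A)) \<and>
         C (subtopology Y (\<Union>\<A>)) \<and> \<not> P (subtopology Y (\<Union>\<A>))}"

definition additivity :: "('a topology \<Rightarrow> bool) \<Rightarrow> ('a topology \<Rightarrow> bool) \<Rightarrow> 'a set rel" where
  "additivity C P = min_card (nonadditive_families C P)"

text \<open>If no family on the given carrier type violates additivity, the minimum is taken over
  the empty class and counts as infinite, i.e. as larger than every cardinal.\<close>

definition le_additivity ::
  "'b rel \<Rightarrow> ('a topology \<Rightarrow> bool) \<Rightarrow> ('a topology \<Rightarrow> bool) \<Rightarrow> bool" where
  "le_additivity \<kappa> C P \<longleftrightarrow> nonadditive_families C P = {} \<or> \<kappa> \<le>o additivity C P"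

end

theory Submission
  imports Defs
begin

text \<open>Group the given covers into disjoint blocks, the \<open>n\<close>-th block consisting of \<open>n\<close> covers,
  and let the sets \<open>V n m\<close> (for \<open>m\<close> in \<open>\<nat>\<close>) refine all covers of the \<open>n\<close>-th block. For each of
  the given subspaces \<open>A\<close> there is a function \<open>f\<close> such that every point of \<open>A\<close> lies in
  \<open>V n (f n)\<close> for infinitely many \<open>n\<close>. Fewer than \<open>add(N)\<close> such functions are captured by one
  slalom, and the at most \<open>n\<close> sets picked by the slalom at \<open>n\<close> can be enlarged to members of
  different covers of the \<open>n\<close>-th block.\<close>

section \<open>From minimal cardinalities to statements about unions\<close>

lemma captured_if_less_add_null:
  assumes "|F| <o add_null"
  shows "captured F"
proof (rule ccontr)
  assume "\<not> captured F"
  then have "F \<in> {F. \<not> captured F}"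
    by simp
  then have "add_null \<le>o |F|"
    unfolding add_null_def using min_card_attained[of "{F. \<not> captured F}"] by force
  then show False
    using assms not_ordLess_ordLeq by blast
qed

text \<open>A violating family of least cardinality lives in some \<open>Y\<close>. Replacing
  \<open>Y\<close> by the subspace on the union, in which every member keeps its topology, makes
  \<open>union\<close> applicable. Well-orders are comparable, so the failure of
  \<open>\<le>o\<close> gives the required \<open><o\<close>.\<close>

lemma le_additivityI:
  fixes C P :: "'a topology \<Rightarrow> bool"
  assumes \<kappa>: "Well_order \<kappa>"
    and union: "\<And>X \<A>. C X \<Longrightarrow> \<Union>\<A> = topspace X \<Longrightarrow> |\<A>| <o \<kappa>
      \<Longrightarrow> (\<And>A. A \<in> \<A> \<Longrightarrow> P (subtopology X A)) \<Longrightarrow> P X"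
  shows "le_additivity \<kappa> C P"
proof (cases "nonadditive_families C P = {}")
  case True
  then show ?thesis
    by (simp add: le_additivity_def)
next
  case False
  then obtain \<A> where \<A>: "\<A> \<in> nonadditive_families C P" and eq: "additivity C P = |\<A>|"
    unfolding additivity_def using min_card_attained by blast
  then obtain Y where sub: "\<A> \<subseteq> Pow (topspace Y)"
    and P: "\<And>A. A \<in> \<A> \<Longrightarrow> P (subtopology Y A)"
    and C: "C (subtopology Y (\<Union>\<A>))" and notP: "\<not> P (subtopology Y (\<Union>\<A>))"
    unfolding nonadditive_families_def by blast
  have "\<kappa> \<le>o |\<A>|"
  proof (rule ccontr)
    assume "\<not> \<kappa> \<le>o |\<A>|"
    then have less: "|\<A>| <o \<kappa>"
      using \<kappa> card_of_Well_order not_ordLeq_iff_ordLess by blast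
    have "P (subtopology Y (\<Union>\<A>))"
    proof (rule union[OF C _ less])
      show "\<Union>\<A> = topspace (subtopology Y (\<Union>\<A>))"
        using sub by auto
      fix A assume "A \<in> \<A>"
      then have "\<Union>\<A> \<inter> A = A"
        by blast
      then show "P (subtopology (subtopology Y (\<Union>\<A>)) A)"
        using P[OF \<open>A \<in> \<A>\<close>] by (simp add: subtopology_subtopology)
    qed
    with notP show False ..
  qed
  then show ?thesis
    by (simp add: le_additivity_def eq)
qed

section \<open>Selections and slaloms\<close>

text \<open>The indices split along \<open>prod_encode\<close> into columns, and a separate
  selection covers \<open>A\<close> within each column. Indices in column \<open>a\<close> are at
  least \<open>a\<close>, so every point is met arbitrarily late. The arbitrary \<open>r\<close> in
  the hypothesis lets it be applied to each column.\<close>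

lemma infinitely_often_selection:
  fixes V :: "nat \<Rightarrow> 'b \<Rightarrow> 'a set"
  assumes "\<And>r :: nat \<Rightarrow> nat. \<exists>f. A \<subseteq> (\<Union>b. V (r b) (f b))"
  shows "\<exists>f. \<forall>x\<in>A. \<exists>\<^sub>\<infinity>n. x \<in> V n (f n)"
proof -
  have "\<forall>a. \<exists>f. A \<subseteq> (\<Union>b. V (prod_encode (a, b)) (f b))"
    by (rule allI) (rule assms)
  then obtain f where f: "\<forall>a. A \<subseteq> (\<Union>b. V (prod_encode (a, b)) (f a b))"
    by (rule choice[THEN exE])
  define g where "g n = (case prod_decode n of (a, b) \<Rightarrow> f a b)" for n
  have "\<exists>n\<ge>a. x \<in> V n (g n)" if x: "x \<in> A" for x a
  proof -
    obtain b where "x \<in> V (prod_encode (a, b)) (f a b)"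
      using f x by blast
    then show ?thesis
      using le_prod_encode_1[of a b] by (intro exI[of _ "prod_encode (a, b)"]) (simp add: g_def)
  qed
  then show ?thesis
    by (auto simp: INFM_nat_le)
qed

text \<open>The \<open>n\<close>-th block consists of the covers with index \<open>prod_encode (n, j)\<close>, \<open>j < n\<close>.\<close>

lemma selection_from_blocks:
  fixes \<U> :: "nat \<Rightarrow> 'a set set" and V :: "nat \<Rightarrow> nat \<Rightarrow> 'a set"
  assumes ne: "\<And>k. \<U> k \<noteq> {}"
    and refines: "\<And>n j m. j < n \<Longrightarrow> \<exists>U\<in>\<U> (prod_encode (n, j)). V n m \<subseteq> U"
    and less: "|\<A>| <o add_null"
    and io: "\<And>A. A \<in> \<A> \<Longrightarrow> \<exists>f. \<forall>x\<in>A. \<exists>\<^sub>\<infinity>n. x \<in> V n (f n)"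
  shows "\<exists>U. (\<forall>k. U k \<in> \<U> k) \<and> \<Union>\<A> \<subseteq> \<Union>(range U)"
proof -
  obtain f where f: "\<And>A x. A \<in> \<A> \<Longrightarrow> x \<in> A \<Longrightarrow> \<exists>\<^sub>\<infinity>n. x \<in> V n (f A n)"
    using io by metis
  have "captured (f ` \<A>)"
    using captured_if_less_add_null ordLeq_ordLess_trans[OF card_of_image less] by blast
  then obtain S :: "nat \<Rightarrow> nat set" where fin: "\<And>n. finite (S n)" and card: "\<And>n. card (S n) \<le> n"
    and S: "\<And>A. A \<in> \<A> \<Longrightarrow> \<forall>\<^sub>F n in sequentially. f A n \<in> S n"
    unfolding captured_def by blast
  \<comment> \<open>The slalom bound matches the block length: at most \<open>n\<close> values are
    picked at \<open>n\<close>, so each can be assigned its own cover of the block.\<close>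
  have "\<exists>e. \<forall>v\<in>S n. \<exists>j<n. v = e j" for n
  proof -
    obtain e where "bij_betw e {0..<card (S n)} (S n)"
      using ex_bij_betw_nat_finite[OF fin] by blast
    then have "\<forall>v\<in>S n. \<exists>j<card (S n). v = e j"
      by (force simp: bij_betw_def)
    then show ?thesis
      using card less_le_trans by blast
  qed
  then obtain e where e: "\<And>n v. v \<in> S n \<Longrightarrow> \<exists>j<n. v = e n j"
    by metis
  have "\<exists>U\<in>\<U> k. \<forall>n j. k = prod_encode (n, j) \<longrightarrow> j < n \<longrightarrow> V n (e n j) \<subseteq> U" for k
  proof -
    obtain n j where k: "k = prod_encode (n, j)"
      by (metis prod_decode_inverse surj_pair)
    show ?thesis
    proof (cases "j < n")
      case True
      then show ?thesis
        using refines[of j n "e n j"] by (auto simp: k)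
    next
      \<comment> \<open>Indices with \<open>n \<le> j\<close> belong to no block, and any member of
        the cover will do.\<close>
      case False
      then show ?thesis
        using ne[of k] by (auto simp: k)
    qed
  qed
  then obtain U where U: "\<And>k. U k \<in> \<U> k"
    and sub: "\<And>n j. j < n \<Longrightarrow> V n (e n j) \<subseteq> U (prod_encode (n, j))"
    by metis
  have "x \<in> \<Union>(range U)" if "A \<in> \<A>" "x \<in> A" for A x
  proof -
    \<comment> \<open>An event that happens infinitely often meets one that holds almost always; a
      single such \<open>n\<close> suffices.\<close>
    have "\<exists>\<^sub>\<infinity>n. x \<in> V n (f A n) \<and> f A n \<in> S n"
      using f[OF that] S[OF that(1)]
      by (simp add: frequently_eventually_conj conj_commute cofinite_eq_sequentially)
    then obtain n where x: "x \<in> V n (f A n)" and "f A n \<in> S n"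
      by (metis (no_types, lifting) INFM_EX)
    then obtain j where "j < n" "f A n = e n j"
      using e[of "f A n" n] by blast
    then have "x \<in> U (prod_encode (n, j))"
      using x sub[of j n] by auto
    then show ?thesis
      by blast
  qed
  then show ?thesis
    using U by blast
qed

text \<open>Each trace chosen in the subspace comes from some index \<open>m\<close>; choosing such
  an index for every \<open>b\<close> pulls the selection back to sets of the whole space.\<close>

lemma selection_from_traces:
  fixes V :: "nat \<Rightarrow> 'b \<Rightarrow> 'a set"
  assumes "S1 P open_covers (subtopology X A)" "A \<subseteq> topspace X"
    and "\<And>b. range (\<lambda>m. A \<inter> V b m) \<in> P (subtopology X A)"
  shows "\<exists>f. A \<subseteq> (\<Union>b. V b (f b))"
proof -
  obtain U where U: "\<And>b. U b \<in> range (\<lambda>m. A \<inter> V b m)"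
    and cover: "range U \<in> open_covers (subtopology X A)"
    using assms unfolding S1_def by meson
  have "\<forall>b. \<exists>m. U b = A \<inter> V b m"
    using U by blast
  then obtain f where f: "\<And>b. U b = A \<inter> V b (f b)"
    by metis
  have "A \<subseteq> \<Union>(range U)"
    using cover assms(2) by (auto simp: open_covers_def)
  then have "A \<subseteq> (\<Union>b. V b (f b))"
    by (auto simp: f)
  then show ?thesis
    by (rule exI[of _ f])
qed

text \<open>Chosen sets are open and lie in the space, so only coverage is left to prove; a range
  over \<open>nat\<close> is never empty, as \<open>open_covers\<close> demands.\<close>

lemma S1_open_coversI:
  fixes X :: "'a topology"
  assumes "\<And>\<U> :: nat \<Rightarrow> 'a set set. (\<And>n. \<U> n \<in> P X)
    \<Longrightarrow> \<exists>U. (\<forall>n. U n \<in> \<U> n) \<and> topspace X \<subseteq> \<Union>(range U)"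
    and "P X \<subseteq> open_covers X"
  shows "S1 P open_covers X"
  unfolding S1_def
proof (intro allI impI)
  fix \<U> :: "nat \<Rightarrow> 'a set set"
  assume \<U>: "\<forall>n. \<U> n \<in> P X"
  then obtain U where U: "\<And>n. U n \<in> \<U> n" and top: "topspace X \<subseteq> \<Union>(range U)"
    using assms(1) by blast
  have "openin X (U n)" for n
    using U \<U> assms(2) by (fastforce simp: open_covers_def)
  then have "range U \<in> open_covers X"
    using top openin_subset by (fastforce simp: open_covers_def)
  then show "\<exists>U. (\<forall>n. U n \<in> \<U> n) \<and> range U \<in> open_covers X"
    using U by blast
qed

section \<open>Rothberger's property in Lindelof spaces\<close>

text \<open>Finite intersections of open sets are open, so the common refinements of finitely many
  covers form a cover, of which a countable subcover is enumerated.\<close>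

lemma Lindelof_refinement:
  assumes L: "Lindelof_space X"
    and \<U>: "\<And>j :: nat. j < n \<Longrightarrow> \<U> j \<in> open_covers X"
  shows "\<exists>V :: nat \<Rightarrow> 'a set. (\<forall>m. openin X (V m)) \<and> topspace X \<subseteq> (\<Union>m. V m) \<and>
    (\<forall>j<n. \<forall>m. \<exists>U\<in>\<U> j. V m \<subseteq> U)"
proof -
  define \<W> where "\<W> = {W. openin X W \<and> (\<forall>j<n. \<exists>U\<in>\<U> j. W \<subseteq> U)}"
  have "x \<in> \<Union>\<W>" if x: "x \<in> topspace X" for x
  proof -
    have "\<forall>j. \<exists>U. j < n \<longrightarrow> U \<in> \<U> j \<and> openin X U \<and> x \<in> U"
      using \<U> x unfolding open_covers_def by blast
    then obtain U where U: "\<And>j. j < n \<Longrightarrow> U j \<in> \<U> j \<and> openin X (U j) \<and> x \<in> U j"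
      by metis
    \<comment> \<open>The factor \<open>topspace X\<close> takes care of \<open>n = 0\<close>, where
      the intersection is \<open>UNIV\<close>.\<close>
    have "openin X (topspace X \<inter> (\<Inter>j<n. U j))"
      using U openin_INT[of "{..<n}" X U] by (simp add: Int_commute)
    then have "topspace X \<inter> (\<Inter>j<n. U j) \<in> \<W>"
      using U by (auto simp: \<W>_def)
    then show ?thesis
      using U x by blast
  qed
  then have "\<Union>\<W> = topspace X"
    using openin_subset by (fastforce simp: \<W>_def)
  then obtain \<V> where \<V>: "countable \<V>" "\<V> \<subseteq> \<W>" "\<Union>\<V> = topspace X"
    using L unfolding Lindelof_space_def by (metis (no_types, lifting) \<W>_def mem_Collect_eq)
  \<comment> \<open>Adjoining the empty set gives \<open>from_nat_into\<close> a nonempty set to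
    enumerate, even if the subcover is empty.\<close>
  have empty: "{} \<in> \<W>"
    using \<U> by (fastforce simp: \<W>_def open_covers_def)
  define V where "V = from_nat_into (insert {} \<V>)"
  have range: "range V = insert {} \<V>"
    unfolding V_def using \<V>(1) by (intro range_from_nat_into) auto
  then have "range V \<subseteq> \<W>"
    using empty \<V>(2) by simp
  then have "V m \<in> \<W>" for m
    by (rule range_subsetD)
  moreover have "(\<Union>m. V m) = topspace X"
    using range \<V>(3) by simp
  ultimately show ?thesis
    by (intro exI[of _ V]) (auto simp: \<W>_def)
qed

text \<open>The Lindelof property provides refinements indexed by \<open>nat\<close>, so that
  selections are functions from \<open>nat\<close> to \<open>nat\<close>, as slaloms
  require.\<close>

lemma S1_open_open_Union:
  assumes L: "Lindelof_space X" and top: "\<Union>\<A> = topspace X" and less: "|\<A>| <o add_null"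
    and S1: "\<And>A. A \<in> \<A> \<Longrightarrow> S1 open_covers open_covers (subtopology X A)"
  shows "S1 open_covers open_covers X"
proof (rule S1_open_coversI)
  fix \<U> :: "nat \<Rightarrow> 'a set set"
  assume \<U>: "\<And>n. \<U> n \<in> open_covers X"
  have "\<exists>V :: nat \<Rightarrow> 'a set. (\<forall>m. openin X (V m)) \<and> topspace X \<subseteq> (\<Union>m. V m) \<and>
      (\<forall>j<n. \<forall>m. \<exists>U\<in>\<U> (prod_encode (n, j)). V m \<subseteq> U)" for n
    by (rule Lindelof_refinement[OF L]) (rule \<U>)
  then obtain V :: "nat \<Rightarrow> nat \<Rightarrow> 'a set" where opn: "\<And>n m. openin X (V n m)"
    and cover: "\<And>n. topspace X \<subseteq> (\<Union>m. V n m)"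
    and refines: "\<And>n j m. j < n \<Longrightarrow> \<exists>U\<in>\<U> (prod_encode (n, j)). V n m \<subseteq> U"
    by metis
  have io: "\<exists>f. \<forall>x\<in>A. \<exists>\<^sub>\<infinity>n. x \<in> V n (f n)" if A: "A \<in> \<A>" for A
  proof (rule infinitely_often_selection)
    fix r :: "nat \<Rightarrow> nat"
    have sub: "A \<subseteq> topspace X"
      using A top by blast
    have "range (\<lambda>m. A \<inter> V n m) \<in> open_covers (subtopology X A)" for n
      using sub opn cover[of n] by (auto simp: open_covers_def openin_subtopology_Int2)
    then show "\<exists>f. A \<subseteq> (\<Union>b. V (r b) (f b))"
      by (rule selection_from_traces[OF S1[OF A] sub])
  qed
  have ne: "\<U> k \<noteq> {}" for k
    using \<U>[of k] by (simp add: open_covers_def)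
  show "\<exists>U. (\<forall>n. U n \<in> \<U> n) \<and> topspace X \<subseteq> \<Union>(range U)"
    unfolding top[symmetric]
    by (rule selection_from_blocks[where V = V]) (fact ne refines less io)+
qed simp

section \<open>Point-cofinite covers\<close>

text \<open>A point-cofinite sequence of sets may have only finitely many traces on a subspace, which
  then do not form a point-cofinite cover; but in that case one of the sets contains the whole
  subspace.\<close>

lemma contains_if_finite_traces:
  fixes V :: "nat \<Rightarrow> 'a set"
  assumes cofin: "\<And>x. x \<in> A \<Longrightarrow> finite {m. x \<notin> V m}"
    and fin: "finite (range (\<lambda>m. A \<inter> V m))"
  shows "\<exists>m. A \<subseteq> V m"
proof -
  obtain k where k: "infinite {m. A \<inter> V m = A \<inter> V k}"
    using pigeonhole_infinite[OF infinite_UNIV_nat fin] by auto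
  have "x \<in> V k" if x: "x \<in> A" for x
  proof (rule ccontr)
    assume "x \<notin> V k"
    then have "{m. A \<inter> V m = A \<inter> V k} \<subseteq> {m. x \<notin> V m}"
      using x by blast
    then show False
      using k cofin[OF x] finite_subset by blast
  qed
  then show ?thesis
    by blast
qed

text \<open>Distinct sets may have equal traces, but the traces missing a point are still the image
  of a finite set of indices.\<close>

lemma range_traces_point_cofinite:
  fixes V :: "nat \<Rightarrow> 'a set"
  assumes A: "A \<subseteq> topspace X"
    and opn: "\<And>m. openin X (V m)"
    and cofin: "\<And>x. x \<in> A \<Longrightarrow> finite {m. x \<notin> V m}"
    and inf: "infinite (range (\<lambda>m. A \<inter> V m))"
  shows "range (\<lambda>m. A \<inter> V m) \<in> point_cofinite_covers (subtopology X A)"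
proof -
  have "\<exists>m. x \<in> V m" if "x \<in> A" for x
    using cofin[OF that] by (auto intro: ccontr)
  then have "range (\<lambda>m. A \<inter> V m) \<in> open_covers (subtopology X A)"
    using A opn by (auto simp: open_covers_def openin_subtopology_Int2)
  moreover have "finite {U \<in> range (\<lambda>m. A \<inter> V m). x \<notin> U}" if "x \<in> A" for x
  proof (rule finite_subset)
    show "{U \<in> range (\<lambda>m. A \<inter> V m). x \<notin> U} \<subseteq> (\<lambda>m. A \<inter> V m) ` {m. x \<notin> V m}"
      using that by blast
  qed (simp add: cofin[OF that])
  ultimately show ?thesis
    using inf A by (simp add: point_cofinite_covers_def)
qed

text \<open>Every point-cofinite cover contains an injective sequence that is itself point-cofinite.
  Termwise intersection of finitely many such sequences only unites finitely many finite sets of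
  exceptions, and so gives refinements indexed by \<open>nat\<close>.\<close>

lemma S1_point_cofinite_open_Union:
  assumes top: "\<Union>\<A> = topspace X" and less: "|\<A>| <o add_null"
    and S1: "\<And>A. A \<in> \<A> \<Longrightarrow> S1 point_cofinite_covers open_covers (subtopology X A)"
  shows "S1 point_cofinite_covers open_covers X"
proof (rule S1_open_coversI)
  fix \<U> :: "nat \<Rightarrow> 'a set set"
  assume \<U>: "\<And>n. \<U> n \<in> point_cofinite_covers X"
  then have "\<exists>e :: nat \<Rightarrow> 'a set. inj e \<and> range e \<subseteq> \<U> k" for k
    by (intro infinite_countable_subset) (simp add: point_cofinite_covers_def)
  then obtain e :: "nat \<Rightarrow> nat \<Rightarrow> 'a set" where inj: "\<And>k. inj (e k)"
    and e: "\<And>k m. e k m \<in> \<U> k"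
    by (metis range_subsetD)
  have e_open: "openin X (e k m)" for k m
    using \<U>[of k] e[of k m] by (simp add: point_cofinite_covers_def open_covers_def)
  have e_cofin: "finite {m. x \<notin> e k m}" if x: "x \<in> topspace X" for x k
  proof (rule finite_subset)
    show "{m. x \<notin> e k m} \<subseteq> e k -` {U \<in> \<U> k. x \<notin> U}"
      using e by auto
    \<comment> \<open>Injectivity turns finitely many missed members into finitely many missed
      indices.\<close>
    show "finite (e k -` {U \<in> \<U> k. x \<notin> U})"
      using \<U>[of k] x inj by (intro finite_vimageI) (auto simp: point_cofinite_covers_def)
  qed
  define V where "V n m = topspace X \<inter> (\<Inter>j<n. e (prod_encode (n, j)) m)" for n m
  have V_open: "openin X (V n m)" for n m
    unfolding V_def using openin_INT[of "{..<n}" X "\<lambda>j. e (prod_encode (n, j)) m"] e_open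
    by (simp add: Int_commute)
  have V_cofin: "finite {m. x \<notin> V n m}" if x: "x \<in> topspace X" for x n
  proof -
    have "{m. x \<notin> V n m} = (\<Union>j<n. {m. x \<notin> e (prod_encode (n, j)) m})"
      using x by (auto simp: V_def)
    then show ?thesis
      using e_cofin[OF x] by simp
  qed
  have refines: "\<exists>U\<in>\<U> (prod_encode (n, j)). V n m \<subseteq> U" if "j < n" for n j m
    using that e by (intro bexI[of _ "e (prod_encode (n, j)) m"]) (auto simp: V_def)
  have io: "\<exists>f. \<forall>x\<in>A. \<exists>\<^sub>\<infinity>n. x \<in> V n (f n)" if A: "A \<in> \<A>" for A
  proof (rule infinitely_often_selection)
    fix r :: "nat \<Rightarrow> nat"
    have sub: "A \<subseteq> topspace X"
      using A top by blast
    then have cofin: "finite {m. x \<notin> V n m}" if "x \<in> A" for x n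
      using V_cofin that by blast
    show "\<exists>f. A \<subseteq> (\<Union>b. V (r b) (f b))"
    proof (cases "\<exists>b. finite (range (\<lambda>m. A \<inter> V (r b) m))")
      \<comment> \<open>One set already contains \<open>A\<close>, so the selection is constant and
        its values at other arguments do not matter.\<close>
      case True
      then obtain b m where "A \<subseteq> V (r b) m"
        using contains_if_finite_traces cofin by metis
      then show ?thesis
        by (intro exI[of _ "\<lambda>_. m"]) blast
    next
      case False
      then have "range (\<lambda>m. A \<inter> V (r b) m) \<in> point_cofinite_covers (subtopology X A)" for b
        using range_traces_point_cofinite[OF sub V_open cofin] by blast
      then show ?thesis
        by (rule selection_from_traces[OF S1[OF A] sub])
    qed
  qed
  have ne: "\<U> k \<noteq> {}" for k
    using e by blast
  show "\<exists>U. (\<forall>n. U n \<in> \<U> n) \<and> topspace X \<subseteq> \<Union>(range U)"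
    unfolding top[symmetric]
    by (rule selection_from_blocks[where V = V]) (fact ne refines less io)+
qed (auto simp: point_cofinite_covers_def)

theorem corollary5p5:
  shows
    "(\<forall>(X :: 'a topology) \<A>.
        Lindelof_space X \<and> \<Union>\<A> = topspace X \<and> |\<A>| <o add_null \<and>
        (\<forall>A\<in>\<A>. S1 open_covers open_covers (subtopology X A))
        \<longrightarrow> S1 open_covers open_covers X) \<and>
     le_additivity add_null Lindelof_space
       (S1 open_covers open_covers :: 'a topology \<Rightarrow> bool) \<and>
     (\<forall>(X :: 'a topology) \<A>.
        \<Union>\<A> = topspace X \<and> |\<A>| <o add_null \<and>
        (\<forall>A\<in>\<A>. S1 point_cofinite_covers open_covers (subtopology X A))
        \<longrightarrow> S1 point_cofinite_covers open_covers X) \<and>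
     le_additivity add_null (\<lambda>_. True)
       (S1 point_cofinite_covers open_covers :: 'a topology \<Rightarrow> bool)"
proof -
  have wo: "Well_order add_null"
    unfolding add_null_def min_card_def by (rule card_of_Well_order)
  show ?thesis
  proof (intro conjI allI impI)
    show "le_additivity add_null Lindelof_space
        (S1 open_covers open_covers :: 'a topology \<Rightarrow> bool)"
      using wo S1_open_open_Union by (rule le_additivityI)
    show "le_additivity add_null (\<lambda>_. True)
        (S1 point_cofinite_covers open_covers :: 'a topology \<Rightarrow> bool)"
      using wo S1_point_cofinite_open_Union by (rule le_additivityI)
  next
    fix X :: "'a topology" and \<A>
    assume "Lindelof_space X \<and> \<Union>\<A> = topspace X \<and> |\<A>| <o add_null \<and>
      (\<forall>A\<in>\<A>. S1 open_covers open_covers (subtopology X A))"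
    then show "S1 open_covers open_covers X"
      by (intro S1_open_open_Union[of X \<A>]) auto
  next
    fix X :: "'a topology" and \<A>
    assume "\<Union>\<A> = topspace X \<and> |\<A>| <o add_null \<and>
      (\<forall>A\<in>\<A>. S1 point_cofinite_covers open_covers (subtopology X A))"
    then show "S1 point_cofinite_covers open_covers X"
      by (intro S1_point_cofinite_open_Union[of \<A> X]) auto
  qed
qed

end
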